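(* Let $E$ be a Banach space with norm $\|\cdot\|$ and let $S(E)=\{e\in E:\|e\|=1\}$. Then the norm $\|\cdot\|$ is of class $C^1$ on $E\setminus\{0\}$ if and only if $S(E)$ is a $C^1$-submanifold of $E$ with $\operatorname{codim} S(E)=1$.
   Context: Banach spaces are real. "The norm is of class $C^1$ on $E\setminus\{0\}$" means that $e\mapsto\|e\|$ is Fréchet differentiable at every point of $E\setminus\{0\}$ and its Fréchet derivative $e\mapsto (D\|\cdot\|)(e)\in E^*$ is continuous on $E\setminus\{0\}$ (operator norm on $E^*$). A subset $S\subset E$ is a $C^1$-submanifold of $E$ if for each $x\in S$ there is an admissible chart $(U,\varphi,E_\varphi)$ of $E$ with $x\in U$ (that is, $U\subset E$ is open, $E_\varphi$ is a Banach space, and $\varphi:U\to\varphi(U)\subset E_\varphi$ is a $C^1$-diffeomorphism onto an open set) such that $E_\varphi$ contains a closed linear subspace $E_0$ which splits $E_\varphi$ (i.e. has a closed complement), and $\varphi(U\cap S)$ is an open set in $E_0$. One writes $\operatorname{codim}S=1$ if at each point of $S$ such a chart has $\dim(E_\varphi/E_0)=1$. *)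

theory Defs
  imports "HOL-Analysis.Analysis"
begin

definition C1_on :: "'a::real_normed_vector set \<Rightarrow> ('a \<Rightarrow> 'b::real_normed_vector) \<Rightarrow> bool"
  where "C1_on U f \<longleftrightarrow>
    (\<exists>f' :: 'a \<Rightarrow> 'a \<Rightarrow>\<^sub>L 'b.
      (\<forall>x\<in>U. (f has_derivative blinfun_apply (f' x)) (at x)) \<and> continuous_on U f')"

text \<open>
  The next two definitions express that \<open>f\<close> is of class \<open>C\<^sup>1\<close> on a relatively open subset \<open>W\<close> of the
  normed space \<open>F\<close>, where \<open>F\<close> is a linear subspace of the type \<open>'g\<close>. The constant \<open>has_derivative\<close>,
  even with \<open>at w within F\<close>, is not suitable here: it asks for a derivative that is bounded and
  linear on all of \<open>'g\<close>, whereas a bounded operator on \<open>F\<close> need not extend boundedly to \<open>'g\<close>.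
  For \<open>F = UNIV\<close> the notion agrees with \<open>C1_on\<close>, see \<open>C1_on_subspace_UNIV\<close> below.
\<close>

definition bounded_linear_on ::
    "'g::real_normed_vector set \<Rightarrow> ('g \<Rightarrow> 'b::real_normed_vector) \<Rightarrow> bool"
  where "bounded_linear_on F L \<longleftrightarrow>
    (\<forall>h\<in>F. \<forall>k\<in>F. L (h + k) = L h + L k) \<and>
    (\<forall>c. \<forall>h\<in>F. L (c *\<^sub>R h) = c *\<^sub>R L h) \<and>
    (\<exists>K. \<forall>h\<in>F. norm (L h) \<le> K * norm h)"

definition C1_on_subspace ::
    "'g::real_normed_vector set \<Rightarrow> 'g set \<Rightarrow> ('g \<Rightarrow> 'b::real_normed_vector) \<Rightarrow> bool"
  where "C1_on_subspace F W f \<longleftrightarrow>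
    (\<exists>D. (\<forall>w\<in>W. bounded_linear_on F (D w) \<and>
              ((\<lambda>y. (f y - f w - D w (y - w)) /\<^sub>R norm (y - w)) \<longlongrightarrow> 0) (at w within W)) \<and>
         (\<forall>w\<in>W. \<forall>\<epsilon>>0. \<exists>\<delta>>0. \<forall>z\<in>W. dist z w < \<delta> \<longrightarrow>
              (\<forall>h\<in>F. norm (D z h - D w h) \<le> \<epsilon> * norm h)))"

lemma bounded_linear_on_UNIV: "bounded_linear_on UNIV L \<longleftrightarrow> bounded_linear L"
proof
  assume "bounded_linear_on UNIV L"
  then obtain K where "\<And>h k. L (h + k) = L h + L k" "\<And>c h. L (c *\<^sub>R h) = c *\<^sub>R L h"
      "\<And>h. norm (L h) \<le> K * norm h"
    by (auto simp: bounded_linear_on_def)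
  then show "bounded_linear L"
    by (intro bounded_linear_intro[where K = K]) (auto simp: mult.commute)
next
  assume L: "bounded_linear L"
  then show "bounded_linear_on UNIV L"
    unfolding bounded_linear_on_def
    using bounded_linear.bounded[OF L]
    by (auto simp: bounded_linear.linear linear_add linear_scale mult.commute)
qed

lemma C1_on_subspace_UNIV:
  assumes "open U"
  shows "C1_on_subspace UNIV U f \<longleftrightarrow> C1_on U f"
proof
  assume "C1_on_subspace UNIV U f"
  then obtain D where
      D: "\<forall>w\<in>U. bounded_linear (D w) \<and>
        ((\<lambda>y. (f y - f w - D w (y - w)) /\<^sub>R norm (y - w)) \<longlongrightarrow> 0) (at w within U)" and
      cont: "\<forall>w\<in>U. \<forall>e>0. \<exists>d>0. \<forall>z\<in>U. dist z w < d \<longrightarrow>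
        (\<forall>h\<in>UNIV. norm (D z h - D w h) \<le> e * norm h)"
    unfolding C1_on_subspace_def bounded_linear_on_UNIV by (elim exE conjE)
  have bl: "bounded_linear (D w)" if "w \<in> U" for w
    using D that by blast
  have lim: "((\<lambda>y. (f y - f w - D w (y - w)) /\<^sub>R norm (y - w)) \<longlongrightarrow> 0) (at w within U)"
    if "w \<in> U" for w
    using D that by blast
  have app: "blinfun_apply (Blinfun (D w)) = D w" if "w \<in> U" for w
    using bl[OF that] by (rule bounded_linear_Blinfun_apply)
  have "(f has_derivative blinfun_apply (Blinfun (D w))) (at w)" if w: "w \<in> U" for w
    using bl[OF w] lim[OF w]
    unfolding app[OF w] has_derivative_at_within at_within_open[OF w assms] by (rule conjI)
  moreover have "continuous_on U (\<lambda>w. Blinfun (D w))"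
    unfolding continuous_on_iff
  proof (intro ballI allI impI)
    fix w and e :: real assume w: "w \<in> U" and e: "0 < e"
    then obtain d where d: "d > 0"
        "\<And>z h. \<lbrakk>z \<in> U; dist z w < d\<rbrakk> \<Longrightarrow> norm (D z h - D w h) \<le> e/2 * norm h"
      using cont[rule_format, of w "e/2"] by auto
    have "dist (Blinfun (D z)) (Blinfun (D w)) < e" if z: "z \<in> U" "dist z w < d" for z
    proof -
      have "norm (Blinfun (D z) - Blinfun (D w)) \<le> e/2"
        using d(2)[OF z] e by (intro norm_blinfun_bound) (auto simp: blinfun.diff_left app w z)
      then show ?thesis using e by (simp add: dist_norm)
    qed
    then show "\<exists>d>0. \<forall>z\<in>U. dist z w < d \<longrightarrow> dist (Blinfun (D z)) (Blinfun (D w)) < e"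
      using d(1) by blast
  qed
  ultimately show "C1_on U f"
    unfolding C1_on_def by (intro exI[of _ "\<lambda>w. Blinfun (D w)"] conjI ballI)
next
  assume "C1_on U f"
  then obtain f' :: "'a \<Rightarrow> 'a \<Rightarrow>\<^sub>L 'b" where
      der: "\<forall>x\<in>U. (f has_derivative blinfun_apply (f' x)) (at x)" and
      cont: "continuous_on U f'"
    unfolding C1_on_def by (elim exE conjE)
  show "C1_on_subspace UNIV U f"
    unfolding C1_on_subspace_def bounded_linear_on_UNIV
  proof (intro exI[of _ "\<lambda>x. blinfun_apply (f' x)"] conjI ballI allI impI)
    fix w assume w: "w \<in> U"
    show "bounded_linear (blinfun_apply (f' w))" by (rule blinfun.bounded_linear_right)
    show "((\<lambda>y. (f y - f w - f' w (y - w)) /\<^sub>R norm (y - w)) \<longlongrightarrow> 0) (at w within U)"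
      using bspec[OF der w]
      unfolding has_derivative_at_within at_within_open[OF w assms] by (rule conjunct2)
    fix e :: real assume e: "e > 0"
    then obtain d where d: "d > 0" "\<And>z. \<lbrakk>z \<in> U; dist z w < d\<rbrakk> \<Longrightarrow> dist (f' z) (f' w) < e"
      using cont w unfolding continuous_on_iff by blast
    have "norm (f' z h - f' w h) \<le> e * norm h" if "z \<in> U" "dist z w < d" for z h
    proof -
      have "norm (f' z h - f' w h) \<le> norm (f' z - f' w) * norm h"
        by (metis blinfun.diff_left norm_blinfun)
      also have "\<dots> \<le> e * norm h"
        using d(2)[OF that] by (intro mult_right_mono) (auto simp: dist_norm)
      finally show ?thesis .
    qed
    then show "\<exists>d>0. \<forall>z\<in>U. dist z w < d \<longrightarrow> (\<forall>h\<in>UNIV. norm (f' z h - f' w h) \<le> e * norm h)"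
      using d(1) by blast
  qed
qed

text \<open>
  HOL cannot quantify over Banach spaces that are types, so the model space \<open>E\<^sub>\<phi>\<close> of a chart ranges
  over the closed linear subspaces \<open>F\<close> of an ambient Banach space \<open>'g\<close>, which plays the role of a
  universe. The spaces \<open>F\<close> may differ from chart to chart. Every set of Banach spaces embeds
  isometrically onto closed subspaces of a single Banach space (for example its supremum-norm sum),
  so a statement proved for all types \<open>'g\<close> covers every choice of model spaces. Conversely, charts
  with model space \<open>E\<close> itself are available only if \<open>'g\<close> contains a copy of \<open>E\<close>; taking \<open>'g\<close> of the
  form \<open>'a \<times> 'f\<close> with \<open>'f\<close> arbitrary achieves both.

  The argument of type \<open>'g itself\<close> below names this universe.
\<close>

definition C1_diffeo_onto_open ::
    "'a::banach set \<Rightarrow> ('a \<Rightarrow> 'g::banach) \<Rightarrow> 'g set \<Rightarrow> bool"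
  where "C1_diffeo_onto_open U \<phi> F \<longleftrightarrow>
    openin (top_of_set F) (\<phi> ` U) \<and> inj_on \<phi> U \<and>
    C1_on U \<phi> \<and> C1_on_subspace F (\<phi> ` U) (inv_into U \<phi>)"

definition admissible_chart :: "'a::banach set \<Rightarrow> ('a \<Rightarrow> 'g::banach) \<Rightarrow> 'g set \<Rightarrow> bool"
  where "admissible_chart U \<phi> F \<longleftrightarrow>
    open U \<and> subspace F \<and> closed F \<and> C1_diffeo_onto_open U \<phi> F"

definition splits :: "'g::real_normed_vector set \<Rightarrow> 'g set \<Rightarrow> bool"
  where "splits F E0 \<longleftrightarrow>
    subspace E0 \<and> closed E0 \<and> E0 \<subseteq> F \<and>
    (\<exists>C. subspace C \<and> closed C \<and> C \<subseteq> F \<and> E0 \<inter> C = {0} \<and> {e + c |e c. e \<in> E0 \<and> c \<in> C} = F)"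

definition submanifold_chart ::
    "'a::banach set \<Rightarrow> 'a \<Rightarrow> 'a set \<Rightarrow> ('a \<Rightarrow> 'g::banach) \<Rightarrow> 'g set \<Rightarrow> 'g set \<Rightarrow> bool"
  where "submanifold_chart S x U \<phi> F E0 \<longleftrightarrow>
    admissible_chart U \<phi> F \<and> x \<in> U \<and> splits F E0 \<and>
    openin (top_of_set E0) (\<phi> ` (U \<inter> S))"

definition C1_submanifold :: "'g::banach itself \<Rightarrow> 'a::banach set \<Rightarrow> bool"
  where "C1_submanifold _ S \<longleftrightarrow>
    (\<forall>x\<in>S. \<exists>U (\<phi> :: 'a \<Rightarrow> 'g) F E0. submanifold_chart S x U \<phi> F E0)"

text \<open>\<open>dim (F / E0) = n\<close>: the cosets of the elements of \<open>B\<close> form a basis of the quotient.\<close>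

definition quotient_dim_eq :: "'g::real_vector set \<Rightarrow> 'g set \<Rightarrow> nat \<Rightarrow> bool"
  where "quotient_dim_eq F E0 n \<longleftrightarrow>
    (\<exists>B. finite B \<and> card B = n \<and> independent B \<and> span B \<inter> E0 = {0} \<and> span (E0 \<union> B) = F)"

definition codim_eq :: "'g::banach itself \<Rightarrow> 'a::banach set \<Rightarrow> nat \<Rightarrow> bool"
  where "codim_eq _ S n \<longleftrightarrow>
    (\<forall>x\<in>S. \<exists>U (\<phi> :: 'a \<Rightarrow> 'g) F E0. submanifold_chart S x U \<phi> F E0 \<and> quotient_dim_eq F E0 n)"

end

theory Submission
  imports Defs
begin

text \<open>
  Write \<open>S\<close> for the unit sphere of \<open>E\<close>. Suppose first that the norm is \<open>C\<^sup>1\<close> off the origin. Fix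
  \<open>x \<in> S\<close> and let \<open>l\<close> be the derivative of the norm at \<open>x\<close>; homogeneity gives \<open>l x = 1\<close>. On the
  half-space \<open>l > 0\<close> every point \<open>y\<close> is determined by the point \<open>y / l y\<close>, in which its ray
  meets the hyperplane \<open>l = 1\<close>, and by its norm. The map \<open>\<phi> y = y / l y + (norm y - 2) x\<close> records both: \<open>l (\<phi> y) = norm y - 1\<close>, and the component of
  \<open>\<phi> y\<close> in the kernel of \<open>l\<close>, along \<open>x\<close>, is \<open>y / l y - x\<close>. Its inverse on \<open>l > -1\<close> rescales the
  point \<open>k w = w - l w x + x\<close> of the hyperplane to norm \<open>1 + l w\<close>, so it is \<open>C\<^sup>1\<close> because the norm
  is, and \<open>\<phi>\<close> carries the part of \<open>S\<close> in the half-space onto the whole kernel of \<open>l\<close>. This is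
  \<open>sphere_chart\<close>.

  Conversely, let \<open>\<phi>\<close> be a chart around a point of \<open>S\<close> whose model space \<open>F\<close> contains \<open>E0\<close> with
  codimension one. A bounded functional on \<open>F\<close> with kernel \<open>E0\<close> turns \<open>\<phi>\<close> into a \<open>C\<^sup>1\<close> function
  \<open>g\<close> that vanishes on \<open>S\<close> near this point. At a point \<open>z\<close> of \<open>S\<close> the derivative \<open>g' z\<close> cannot kill
  the radial direction \<open>z\<close>: otherwise \<open>\<phi>'(z) z\<close> would lie in \<open>E0\<close>, and pulling back the line through
  \<open>\<phi> z\<close> in this direction would give a curve in \<open>S\<close> with velocity \<open>z\<close> at \<open>z\<close>, along which the
  norm grows (\<open>chart_derivative_transversal\<close>). Inserting \<open>y / norm y\<close> into the first-order expansion
  of \<open>g\<close> at \<open>z\<close> then shows that the norm is differentiable at \<open>z\<close> with derivative \<open>g' z / g' z z\<close>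
  (\<open>norm_has_derivative_of_defining_function\<close>). This depends continuously on \<open>z\<close>, and by homogeneity
  the derivative of the norm at any \<open>y \<noteq> 0\<close> is the one at \<open>y / norm y\<close> (\<open>norm_C1_of_sphere\<close>).
\<close>

section \<open>Calculus of \<open>C\<^sup>1\<close> maps\<close>

lemma C1_onI:
  fixes f' :: "'a::real_normed_vector \<Rightarrow> 'a \<Rightarrow>\<^sub>L 'b::real_normed_vector"
  assumes "\<And>x. x \<in> U \<Longrightarrow> (f has_derivative f' x) (at x)" "continuous_on U f'"
  shows "C1_on U f"
  using assms unfolding C1_on_def by blast

lemma C1_onE:
  fixes f :: "'a::real_normed_vector \<Rightarrow> 'b::real_normed_vector"
  assumes "C1_on U f"
  obtains f' :: "'a \<Rightarrow> 'a \<Rightarrow>\<^sub>L 'b"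
  where "\<And>x. x \<in> U \<Longrightarrow> (f has_derivative f' x) (at x)" "continuous_on U f'"
  using assms unfolding C1_on_def by blast

lemma C1_on_imp_continuous_on: "C1_on U f \<Longrightarrow> continuous_on U f"
  by (meson C1_onE continuous_at_imp_continuous_on has_derivative_continuous)

lemma C1_on_const: "C1_on U (\<lambda>x. c)"
  by (rule C1_onI[where f' = "\<lambda>_. 0"]) (auto intro!: derivative_eq_intros continuous_intros)

lemma C1_on_blinfun:
  fixes L :: "'a::real_normed_vector \<Rightarrow>\<^sub>L 'b::real_normed_vector"
  shows "C1_on U L"
  by (rule C1_onI[where f' = "\<lambda>_. L"])
    (auto intro!: continuous_intros bounded_linear_imp_has_derivative blinfun.bounded_linear_right)

lemma C1_on_add:
  assumes "C1_on U f" "C1_on U g"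
  shows "C1_on U (\<lambda>x. f x + g x)"
proof -
  obtain f' where f: "\<And>x. x \<in> U \<Longrightarrow> (f has_derivative blinfun_apply (f' x)) (at x)" "continuous_on U f'"
    using C1_onE[OF assms(1)] by blast
  obtain g' where g: "\<And>x. x \<in> U \<Longrightarrow> (g has_derivative blinfun_apply (g' x)) (at x)" "continuous_on U g'"
    using C1_onE[OF assms(2)] by blast
  show ?thesis
  proof (rule C1_onI)
    show "((\<lambda>x. f x + g x) has_derivative blinfun_apply (f' x + g' x)) (at x)" if "x \<in> U" for x
      by (rule has_derivative_eq_rhs[OF has_derivative_add[OF f(1) g(1)]])
        (auto simp: that blinfun.add_left)
  qed (intro continuous_intros f g)
qed

lemma C1_on_scaleR:
  fixes r :: "'a::real_normed_vector \<Rightarrow> real" and f :: "'a \<Rightarrow> 'b::real_normed_vector"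
  assumes "C1_on U r" "C1_on U f"
  shows "C1_on U (\<lambda>x. r x *\<^sub>R f x)"
proof -
  obtain r' :: "'a \<Rightarrow> 'a \<Rightarrow>\<^sub>L real"
    where r: "\<And>x. x \<in> U \<Longrightarrow> (r has_derivative r' x) (at x)" "continuous_on U r'"
    using C1_onE[OF assms(1)] by blast
  obtain f' :: "'a \<Rightarrow> 'a \<Rightarrow>\<^sub>L 'b"
    where f: "\<And>x. x \<in> U \<Longrightarrow> (f has_derivative f' x) (at x)" "continuous_on U f'"
    using C1_onE[OF assms(2)] by blast
  show ?thesis
  proof (rule C1_onI)
    show "((\<lambda>x. r x *\<^sub>R f x) has_derivative
        blinfun_apply (r x *\<^sub>R f' x + (blinfun_scaleR_left (f x) o\<^sub>L r' x))) (at x)" if "x \<in> U" for x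
      by (rule has_derivative_eq_rhs[OF has_derivative_scaleR[OF r(1) f(1)]])
        (auto simp: that blinfun.add_left blinfun.scaleR_left)
    show "continuous_on U (\<lambda>x. r x *\<^sub>R f' x + (blinfun_scaleR_left (f x) o\<^sub>L r' x))"
      by (intro continuous_intros bounded_bilinear.continuous_on[OF bounded_bilinear_blinfun_compose]
          bounded_linear.continuous_on[OF bounded_linear_blinfun_scaleR_left]
          C1_on_imp_continuous_on assms f r)
  qed
qed

lemma C1_on_compose:
  fixes f :: "'a::real_normed_vector \<Rightarrow> 'b::real_normed_vector"
    and g :: "'b \<Rightarrow> 'c::real_normed_vector"
  assumes "C1_on V g" "C1_on U f" "f ` U \<subseteq> V"
  shows "C1_on U (\<lambda>x. g (f x))"
proof -
  obtain g' :: "'b \<Rightarrow> 'b \<Rightarrow>\<^sub>L 'c"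
    where g: "\<And>x. x \<in> V \<Longrightarrow> (g has_derivative g' x) (at x)" "continuous_on V g'"
    using C1_onE[OF assms(1)] by blast
  obtain f' :: "'a \<Rightarrow> 'a \<Rightarrow>\<^sub>L 'b"
    where f: "\<And>x. x \<in> U \<Longrightarrow> (f has_derivative f' x) (at x)" "continuous_on U f'"
    using C1_onE[OF assms(2)] by blast
  show ?thesis
  proof (rule C1_onI)
    show "((\<lambda>x. g (f x)) has_derivative blinfun_apply (g' (f x) o\<^sub>L f' x)) (at x)" if "x \<in> U" for x
      by (rule has_derivative_eq_rhs[OF has_derivative_compose[OF f(1) g(1)]])
        (use that assms(3) in auto)
    show "continuous_on U (\<lambda>x. g' (f x) o\<^sub>L f' x)"
      by (intro bounded_bilinear.continuous_on[OF bounded_bilinear_blinfun_compose]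
          continuous_on_compose2[OF g(2)] C1_on_imp_continuous_on assms f)
  qed
qed

text \<open>
  This transfers an inverse chart from the space \<open>'a\<close> to its copy \<open>'a \<times> {0}\<close> inside the universe
  \<open>'a \<times> 'f\<close>. Only the values of \<open>\<psi>\<close> on \<open>V \<times> {0}\<close> are prescribed, as befits an inverse given by
  \<^const>\<open>inv_into\<close>.
\<close>

lemma C1_on_subspace_embedded:
  fixes \<theta> :: "'a::real_normed_vector \<Rightarrow> 'b::real_normed_vector"
  assumes C1: "C1_on V \<theta>" and \<psi>: "\<And>v. v \<in> V \<Longrightarrow> \<psi> (v, 0) = \<theta> v"
  shows "C1_on_subspace (UNIV \<times> {0 :: 'f::real_normed_vector}) (V \<times> {0}) \<psi>"
proof -
  obtain t' :: "'a \<Rightarrow> 'a \<Rightarrow>\<^sub>L 'b"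
    where t': "\<And>v. v \<in> V \<Longrightarrow> (\<theta> has_derivative t' v) (at v)" "continuous_on V t'"
    using C1_onE[OF C1] by blast
  show ?thesis
    unfolding C1_on_subspace_def
  proof (intro exI[of _ "\<lambda>w h. t' (fst w) (fst h)"] conjI ballI allI impI)
    fix w :: "'a \<times> 'f" assume w: "w \<in> V \<times> {0}"
    then obtain v where v: "w = (v, 0)" "v \<in> V" by auto
    show "bounded_linear_on (UNIV \<times> {0}) (\<lambda>h. t' (fst w) (fst h))"
      unfolding bounded_linear_on_def
      by (auto simp: blinfun.add_right blinfun.scaleR_right norm_Pair intro!: exI[of _ "norm (t' (fst w))"] norm_blinfun)
    have "(\<theta> has_derivative t' v) (at v)" using t' v by blast
    then have lim: "((\<lambda>y. (\<theta> y - \<theta> v - t' v (y - v)) /\<^sub>R norm (y - v)) \<longlongrightarrow> 0) (at v)"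
      by (simp add: has_derivative_at_within)
    have "filterlim fst (at v) (at w within V \<times> {0})"
      unfolding filterlim_at v(1)
      by (auto intro!: tendsto_eq_intros simp: eventually_at intro!: exI[of _ 1])
    from filterlim_compose[OF lim this]
    show "((\<lambda>y. (\<psi> y - \<psi> w - t' (fst w) (fst (y - w))) /\<^sub>R norm (y - w)) \<longlongrightarrow> 0) (at w within V \<times> {0})"
      by (rule Lim_transform_eventually)
        (auto simp: eventually_at v \<psi> norm_Pair intro!: exI[of _ 1])
    fix e :: real assume e: "e > 0"
    then obtain d where d: "d > 0" "\<And>z. \<lbrakk>z \<in> V; dist z v < d\<rbrakk> \<Longrightarrow> dist (t' z) (t' v) < e"
      using t'(2)[unfolded continuous_on_iff, rule_format, OF v(2)] by meson
    have "norm (t' (fst z) (fst h) - t' (fst w) (fst h)) \<le> e * norm h"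
      if "z \<in> V \<times> {0}" "dist z w < d" "h \<in> UNIV \<times> {0}" for z h :: "'a \<times> 'f"
    proof -
      have "norm (t' (fst z) (fst h) - t' (fst w) (fst h)) \<le> norm (t' (fst z) - t' (fst w)) * norm (fst h)"
        by (metis blinfun.diff_left norm_blinfun)
      also have "\<dots> \<le> e * norm (fst h)"
        using d(2)[of "fst z"] that v by (intro mult_right_mono) (auto simp: dist_norm norm_Pair)
      also have "norm (fst h) = norm h" using that by (auto simp: norm_Pair)
      finally show ?thesis .
    qed
    then show "\<exists>d>0. \<forall>z\<in>V \<times> {0}. dist z w < d \<longrightarrow>
        (\<forall>h\<in>UNIV \<times> {0 :: 'f}. norm (t' (fst z) (fst h) - t' (fst w) (fst h)) \<le> e * norm h)"
      using d(1) by blast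
  qed
qed

section \<open>Charts of the unit sphere of a \<open>C\<^sup>1\<close> norm\<close>

lemma norm_derivative_radial:
  assumes "(norm has_derivative l) (at x)" "x \<noteq> 0"
  shows "l x = norm x"
proof -
  have "((\<lambda>t. t *\<^sub>R x) has_derivative (\<lambda>t. t *\<^sub>R x)) (at (1::real))"
    by (auto intro!: derivative_eq_intros)
  then have "((\<lambda>t. norm (t *\<^sub>R x)) has_derivative (\<lambda>t. l (t *\<^sub>R x))) (at (1::real))"
    by (rule has_derivative_compose) (use assms in simp)
  moreover have "((\<lambda>t. norm (t *\<^sub>R x)) has_derivative (\<lambda>t. t * norm x)) (at (1::real))"
    by (rule has_derivative_transform_within_open[of "\<lambda>t. t * norm x" _ _ _ "{0<..}"])
      (auto intro!: derivative_eq_intros)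
  ultimately have "(\<lambda>t. l (t *\<^sub>R x)) = (\<lambda>t. t * norm x)" by (rule has_derivative_unique)
  from fun_cong[OF this, of 1] show ?thesis by simp
qed

text \<open>
  The vector \<open>x\<close> spans a complement of the kernel of \<open>l\<close>, by \<open>v = (v - l v x) + l v x\<close>. The span
  is closed because it is cut out by the continuous equation \<open>v = l v x\<close>.
\<close>

lemma kernel_splits_product:
  fixes l :: "'a::real_normed_vector \<Rightarrow>\<^sub>L real"
  assumes lx: "l x = 1"
  defines "F \<equiv> (UNIV :: 'a set) \<times> {0 :: 'f::real_normed_vector}"
    and "E0 \<equiv> {w. l w = 0} \<times> {0 :: 'f}"
  shows "subspace F" "closed F" "splits F E0" "quotient_dim_eq F E0 1"
proof -
  show F: "subspace F" unfolding F_def by (simp add: subspace_def zero_prod_def)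
  show clF: "closed F" unfolding F_def by (intro closed_Times closed_UNIV closed_singleton)
  have E0: "subspace E0" "closed E0" "E0 \<subseteq> F"
  proof -
    show "subspace E0"
      unfolding E0_def by (simp add: subspace_def zero_prod_def blinfun.add_right blinfun.scaleR_right)
    have "closed {w. l w = 0}" by (intro closed_Collect_eq continuous_intros)
    then show "closed E0" unfolding E0_def by (intro closed_Times closed_singleton)
    show "E0 \<subseteq> F" unfolding E0_def F_def by auto
  qed
  have decomp: "(v, 0) = (v - l v *\<^sub>R x, 0) + l v *\<^sub>R (x, 0 :: 'f)" "(v - l v *\<^sub>R x, 0 :: 'f) \<in> E0" for v
    by (auto simp: E0_def blinfun.diff_right blinfun.scaleR_right lx)
  let ?C = "span {(x, 0 :: 'f)}"
  have C: "?C = range (\<lambda>t. t *\<^sub>R (x, 0))" by (rule span_singleton)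
  have CE0: "?C \<inter> E0 = {0}"
    unfolding C by (auto simp: E0_def blinfun.scaleR_right lx zero_prod_def)
  show "splits F E0"
    unfolding splits_def
  proof (intro conjI E0 exI[of _ ?C])
    have "?C = {w. fst w = l (fst w) *\<^sub>R x} \<inter> F"
    proof (intro subset_antisym subsetI)
      fix w assume "w \<in> {w. fst w = l (fst w) *\<^sub>R x} \<inter> F"
      then have "w = l (fst w) *\<^sub>R (x, 0)" by (simp add: F_def prod_eq_iff mem_Times_iff)
      then show "w \<in> ?C" unfolding C by (rule range_eqI)
    qed (auto simp: C F_def blinfun.scaleR_right lx)
    moreover have "closed {w :: 'a \<times> 'f. fst w = l (fst w) *\<^sub>R x}"
      by (intro closed_Collect_eq continuous_intros)
    ultimately show "closed ?C" using clF by (simp only: closed_Int)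
    show "?C \<subseteq> F" unfolding C F_def by auto
    show "E0 \<inter> ?C = {0}" using CE0 by blast
    show "{e + c |e c. e \<in> E0 \<and> c \<in> ?C} = F"
    proof (intro subset_antisym subsetI)
      fix p assume "p \<in> F"
      then obtain v where v: "p = (v, 0)" by (auto simp: F_def)
      show "p \<in> {e + c |e c. e \<in> E0 \<and> c \<in> ?C}"
        unfolding v using decomp[of v] C by blast
    qed (auto simp: E0_def F_def C)
  qed (rule subspace_span)
  show "quotient_dim_eq F E0 1"
    unfolding quotient_dim_eq_def
  proof (intro exI[of _ "{(x, 0)}"] conjI CE0)
    have "x \<noteq> 0" using lx by (auto simp: blinfun.zero_right)
    then show "independent {(x, 0 :: 'f)}" by (simp add: zero_prod_def)
    show "span (E0 \<union> {(x, 0)}) = F"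
    proof (rule span_subspace[OF _ _ F])
      show "E0 \<union> {(x, 0)} \<subseteq> F" using E0(3) by (auto simp: F_def)
      show "F \<subseteq> span (E0 \<union> {(x, 0)})"
      proof
        fix p assume "p \<in> F"
        then obtain v where v: "p = (v, 0)" by (auto simp: F_def)
        show "p \<in> span (E0 \<union> {(x, 0)})"
          unfolding v decomp(1)[of v]
          by (rule span_add[OF span_base span_scale[OF span_base]]) (use decomp(2)[of v] in auto)
      qed
    qed
  qed auto
qed

text \<open>
  The chart \<open>\<phi>\<close> has the inverse \<open>\<theta>\<close>, where \<open>k w\<close> is the projection of \<open>w\<close> along \<open>x\<close> to the hyperplane \<open>l = 1\<close>:
  the norm of \<open>y\<close> is \<open>l (\<phi> y) + 1\<close>, and the ray of \<open>y\<close> meets the hyperplane in \<open>k (\<phi> y)\<close>. In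
  \<open>\<phi>\<close> the constant \<open>-2\<close> makes the sphere correspond to \<open>l = 0\<close>, since
  \<open>l (y / l y) = 1\<close> contributes one and the norm another one.
\<close>

lemma sphere_chart:
  fixes x :: "'a::banach"
  assumes C1: "C1_on (- {0}) (norm :: 'a \<Rightarrow> real)" and x: "norm x = 1"
  shows "\<exists>U (\<phi> :: 'a \<Rightarrow> 'a \<times> 'f::banach) F E0.
    submanifold_chart {e. norm e = 1} x U \<phi> F E0 \<and> quotient_dim_eq F E0 1"
proof -
  have x0: "x \<noteq> 0" using x by auto
  obtain l :: "'a \<Rightarrow>\<^sub>L real" where "(norm has_derivative l) (at x)"
    using C1_onE[OF C1] x0 by (metis ComplI singletonD)
  then have lx: "l x = 1" using norm_derivative_radial x x0 by metis
  define \<phi> where "\<phi> y = y /\<^sub>R l y + (norm y + (- 2)) *\<^sub>R x" for y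
  \<comment> \<open>Written with a bounded operator so that \<open>k\<close> is visibly of class \<open>C\<^sup>1\<close>; the affine formula is
    the fact \<open>k\<close> below.\<close>
  define k where "k w = (id_blinfun - (blinfun_scaleR_left x o\<^sub>L l)) w + x" for w
  define \<theta> where "\<theta> w = (l w + 1) *\<^sub>R (k w /\<^sub>R norm (k w))" for w
  define U where "U = {y. l y > 0}"
  define V where "V = {w. l w > - 1}"
  have k: "k w = w - l w *\<^sub>R x + x" for w
    by (simp add: k_def blinfun.diff_left)
  have lk: "l (k w) = 1" for w
    by (simp add: k blinfun.diff_right blinfun.add_right blinfun.scaleR_right lx)
  then have k0: "k w \<noteq> 0" for w by (metis blinfun.zero_right zero_neq_one)
  have U0: "y \<noteq> 0" if "y \<in> U" for y using that by (auto simp: U_def)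
  have opUV: "open U" "open V"
    unfolding U_def V_def by (intro open_Collect_less continuous_intros)+
  have l\<phi>: "l (\<phi> y) = norm y - 1" if "y \<in> U" for y
    using that by (simp add: \<phi>_def U_def blinfun.add_right blinfun.scaleR_right lx)
  have k\<phi>: "k (\<phi> y) = y /\<^sub>R l y" if "y \<in> U" for y
    unfolding k l\<phi>[OF that] by (simp add: \<phi>_def algebra_simps scaleR_2)
  have \<theta>\<phi>: "\<theta> (\<phi> y) = y" if "y \<in> U" for y
  proof -
    have ly: "l y > 0" using that by (simp add: U_def)
    then have "norm (k (\<phi> y)) = norm y / l y" by (simp add: k\<phi>[OF that] field_simps)
    then have "\<theta> (\<phi> y) = (norm y * (l y / norm y) * inverse (l y)) *\<^sub>R y"
      by (simp add: \<theta>_def l\<phi>[OF that] k\<phi>[OF that])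
    also have "norm y * (l y / norm y) * inverse (l y) = 1" using ly U0[OF that] by simp
    finally show ?thesis by simp
  qed
  have \<theta>U: "\<theta> w \<in> U" if "w \<in> V" for w
    using that k0 by (simp add: \<theta>_def U_def V_def blinfun.scaleR_right lk)
  have norm\<theta>: "norm (\<theta> w) = l w + 1" if "w \<in> V" for w
    using that k0 by (simp add: \<theta>_def V_def)
  have \<phi>\<theta>: "\<phi> (\<theta> w) = w" if "w \<in> V" for w
  proof -
    define c where "c = (l w + 1) * inverse (norm (k w))"
    have "\<theta> w = c *\<^sub>R k w" by (simp add: \<theta>_def c_def)
    moreover have "c \<noteq> 0" using that k0[of w] by (simp add: c_def V_def)
    ultimately have "inverse (l (\<theta> w)) *\<^sub>R \<theta> w = k w"
      by (simp add: blinfun.scaleR_right lk)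
    then show ?thesis
      unfolding \<phi>_def norm\<theta>[OF that] by (simp add: k algebra_simps scaleR_2)
  qed
  have \<phi>V: "\<phi> y \<in> V" if "y \<in> U" for y
    using that U0[OF that] by (simp add: V_def l\<phi>)
  have \<phi>U: "\<phi> ` U = V"
    using \<phi>V \<phi>\<theta> \<theta>U by (auto simp: image_iff) (metis \<phi>\<theta> \<theta>U)
  have divideR: "C1_on W (\<lambda>y. f y /\<^sub>R r y)"
    if f: "C1_on W f" and C1r: "C1_on W r" and r0: "\<And>y. y \<in> W \<Longrightarrow> r y \<noteq> 0"
    for W :: "'a set" and r :: "'a \<Rightarrow> real" and f :: "'a \<Rightarrow> 'a"
  proof -
    obtain r' :: "'a \<Rightarrow> 'a \<Rightarrow>\<^sub>L real"
      where r: "\<And>x. x \<in> W \<Longrightarrow> (r has_derivative r' x) (at x)" "continuous_on W r'"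
      using C1_onE[OF C1r] by blast
    have "C1_on W (\<lambda>x. inverse (r x))"
    proof (rule C1_onI)
      fix x assume x: "x \<in> W"
      show "((\<lambda>x. inverse (r x)) has_derivative - (inverse (r x) * inverse (r x)) *\<^sub>R r' x) (at x)"
        by (rule has_derivative_eq_rhs[OF Deriv.has_derivative_inverse[OF r0[OF x] r(1)[OF x]]])
          (simp add: fun_eq_iff blinfun.scaleR_left blinfun.minus_left)
    next
      show "continuous_on W (\<lambda>x. - (inverse (r x) * inverse (r x)) *\<^sub>R r' x)"
        using r0 by (intro continuous_intros C1_on_imp_continuous_on[OF C1r] r(2)) auto
    qed
    then show ?thesis using f by (rule C1_on_scaleR)
  qed
  have C1\<phi>: "C1_on U \<phi>"
  proof -
    have id: "C1_on U (\<lambda>y. y)" using C1_on_blinfun[of U id_blinfun] by (simp add: id_blinfun.rep_eq)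
    have "C1_on U (\<lambda>y. y /\<^sub>R l y)"
      by (rule divideR[OF id C1_on_blinfun]) (auto simp: U_def)
    moreover have "C1_on U (norm :: 'a \<Rightarrow> real)"
      using C1_on_compose[OF C1 id] U0 by blast
    ultimately show ?thesis
      unfolding \<phi>_def by (intro C1_on_add C1_on_scaleR[of _ _ "\<lambda>_. x"] C1_on_const)
  qed
  have C1\<theta>: "C1_on V \<theta>"
  proof -
    have k1: "C1_on V k" unfolding k_def by (intro C1_on_add C1_on_blinfun C1_on_const)
    have nk: "C1_on V (\<lambda>w. norm (k w))"
      by (rule C1_on_compose[OF C1 k1]) (use k0 in auto)
    have "C1_on V (\<lambda>w. k w /\<^sub>R norm (k w))"
      using k1 nk by (rule divideR) (use k0 in auto)
    with C1_on_add[OF C1_on_blinfun C1_on_const] show ?thesis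
      unfolding \<theta>_def by (rule C1_on_scaleR)
  qed
  define \<Phi> :: "'a \<Rightarrow> 'a \<times> 'f" where "\<Phi> y = (\<phi> y, 0)" for y
  define F :: "('a \<times> 'f) set" where "F = UNIV \<times> {0}"
  define E0 :: "('a \<times> 'f) set" where "E0 = {w. l w = 0} \<times> {0}"
  have \<Phi>U: "\<Phi> ` U = V \<times> {0}" unfolding \<Phi>_def using \<phi>U by auto
  have inj: "inj_on \<Phi> U"
    by (rule inj_on_inverseI[where g = "\<lambda>p. \<theta> (fst p)"]) (simp add: \<Phi>_def \<theta>\<phi>)
  have F: "subspace F" "closed F" and "splits F E0" and "quotient_dim_eq F E0 1"
    unfolding F_def E0_def using kernel_splits_product[OF lx, where 'f = 'f] by blast+
  have "C1_diffeo_onto_open U \<Phi> F"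
    unfolding C1_diffeo_onto_open_def
  proof (intro conjI inj)
    show "openin (top_of_set F) (\<Phi> ` U)"
      unfolding openin_open \<Phi>U F_def
      by (rule exI[of _ "V \<times> UNIV"]) (auto intro!: open_Times opUV)
    have "bounded_linear (\<lambda>v :: 'a. (v, 0 :: 'f))"
      by (intro bounded_linear_Pair bounded_linear_ident bounded_linear_zero)
    then show "C1_on U \<Phi>"
      using C1_on_compose[OF C1_on_blinfun[of UNIV "Blinfun (\<lambda>v :: 'a. (v, 0 :: 'f))"] C1\<phi>]
      unfolding \<Phi>_def by (simp add: bounded_linear_Blinfun_apply)
    have "inv_into U \<Phi> (v, 0) = \<theta> v" if "v \<in> V" for v
      using inv_into_f_f[OF inj \<theta>U[OF that]] \<phi>\<theta>[OF that] by (simp add: \<Phi>_def)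
    then show "C1_on_subspace F (\<Phi> ` U) (inv_into U \<Phi>)"
      unfolding \<Phi>U F_def by (intro C1_on_subspace_embedded[OF C1\<theta>])
  qed
  then have adm: "admissible_chart U \<Phi> F"
    unfolding admissible_chart_def using opUV F by blast
  have "\<Phi> ` (U \<inter> {e. norm e = 1}) = E0"
  proof (intro subset_antisym subsetI)
    fix p assume "p \<in> E0"
    then obtain v where v: "p = (v, 0)" "l v = 0" by (auto simp: E0_def)
    then have "v \<in> V" by (simp add: V_def)
    then show "p \<in> \<Phi> ` (U \<inter> {e. norm e = 1})"
      using v by (intro image_eqI[of _ _ "\<theta> v"]) (auto simp: \<Phi>_def \<phi>\<theta> norm\<theta> \<theta>U)
  qed (auto simp: \<Phi>_def E0_def l\<phi>)
  then have "submanifold_chart {e. norm e = 1} x U \<Phi> F E0"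
    unfolding submanifold_chart_def using adm \<open>splits F E0\<close> by (simp add: U_def lx)
  then show ?thesis using \<open>quotient_dim_eq F E0 1\<close> by blast
qed

section \<open>Maps that are differentiable along a closed subspace\<close>

text \<open>
  Difference quotients of a map into \<open>F\<close> stay in \<open>F\<close>, and so do their limits.
\<close>

lemma derivative_in_closed_subspace:
  assumes p: "(p has_derivative p') (at x)" and F: "subspace F" "closed F"
    and ev: "\<forall>\<^sub>F y in nhds x. p y \<in> F"
  shows "p' h \<in> F"
proof -
  interpret p': bounded_linear p' using p by (rule has_derivative_bounded_linear)
  have "((\<lambda>t. x + t *\<^sub>R h) has_derivative (\<lambda>t. t *\<^sub>R h)) (at (0::real))"
    by (auto intro!: derivative_eq_intros)
  then have "((\<lambda>t. p (x + t *\<^sub>R h)) has_derivative (\<lambda>t. p' (t *\<^sub>R h))) (at (0::real))"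
    by (rule has_derivative_compose) (use p in simp)
  then have "((\<lambda>t. p (x + t *\<^sub>R h)) has_vector_derivative p' h) (at (0::real))"
    by (simp add: has_vector_derivative_def p'.scaleR)
  have lim: "((\<lambda>t. (p (x + t *\<^sub>R h) - p x) /\<^sub>R t) \<longlongrightarrow> p' h) (at 0)"
  proof -
    have "((\<lambda>t. (p (x + t *\<^sub>R h) - p x - t *\<^sub>R p' h) /\<^sub>R \<bar>t\<bar>) \<longlongrightarrow> 0) (at (0::real))"
      using \<open>((\<lambda>t. p (x + t *\<^sub>R h)) has_vector_derivative p' h) (at 0)\<close>
      by (simp add: has_vector_derivative_def has_derivative_at_within)
    then have "((\<lambda>t. (p (x + t *\<^sub>R h) - p x - t *\<^sub>R p' h) /\<^sub>R t) \<longlongrightarrow> 0) (at (0::real))"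
      by (rule Lim_null_comparison[rotated, OF tendsto_norm_zero]) (simp add: eventually_at)
    then have "((\<lambda>t. (p (x + t *\<^sub>R h) - p x - t *\<^sub>R p' h) /\<^sub>R t + p' h) \<longlongrightarrow> 0 + p' h) (at (0::real))"
      by (intro tendsto_add tendsto_const)
    then have "((\<lambda>t. (p (x + t *\<^sub>R h) - p x - t *\<^sub>R p' h) /\<^sub>R t + p' h) \<longlongrightarrow> p' h) (at (0::real))"
      by simp
    then show ?thesis
      by (rule Lim_transform_eventually) (simp_all add: eventually_at exI[of _ 1] scaleR_diff_right)
  qed
  have x: "p x \<in> F" using eventually_nhds_x_imp_x[OF ev] .
  have "((\<lambda>t. x + t *\<^sub>R h) \<longlongrightarrow> x) (at (0::real))"
    by (auto intro!: tendsto_eq_intros)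
  with ev have "\<forall>\<^sub>F t in at (0::real). p (x + t *\<^sub>R h) \<in> F"
    by (rule eventually_compose_filterlim)
  then have "\<forall>\<^sub>F t in at (0::real). (p (x + t *\<^sub>R h) - p x) /\<^sub>R t \<in> F"
    by eventually_elim (intro subspace_scale subspace_diff F x)
  from Lim_in_closed_set[OF F(2) this _ lim] show ?thesis by simp
qed

text \<open>
  The chain rule when the outer map is differentiable only along the subspace \<open>F\<close>: its derivative
  \<open>D\<close> is defined on \<open>F\<close> and need not extend to a bounded operator on the ambient space, so the usual
  chain rule does not apply. It serves for three compositions: a chart followed by its inverse, a
  line in the model space followed by the inverse chart, and a chart followed by a functional on
  \<open>F\<close>.
\<close>

lemma has_derivative_compose_subspace:
  fixes p :: "'a::real_normed_vector \<Rightarrow> 'g::real_normed_vector"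
    and q :: "'g \<Rightarrow> 'b::real_normed_vector"
  assumes p: "(p has_derivative p') (at x)"
    and F: "subspace F" "closed F" "W \<subseteq> F"
    and ev: "\<forall>\<^sub>F y in nhds x. p y \<in> W"
    and D: "bounded_linear_on F D"
    and q: "((\<lambda>w. (q w - q (p x) - D (w - p x)) /\<^sub>R norm (w - p x)) \<longlongrightarrow> 0) (at (p x) within W)"
  shows "((\<lambda>y. q (p y)) has_derivative (\<lambda>h. D (p' h))) (at x)"
proof -
  interpret p': bounded_linear p' using p by (rule has_derivative_bounded_linear)
  have "\<forall>\<^sub>F y in nhds x. p y \<in> F" using ev by eventually_elim (use F in auto)
  then have p'F: "p' h \<in> F" for h
    by (rule derivative_in_closed_subspace[OF p F(1,2)])
  have px: "p x \<in> W" using eventually_nhds_x_imp_x[OF ev] .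
  from D obtain K0 where D_add: "\<And>h k. h \<in> F \<Longrightarrow> k \<in> F \<Longrightarrow> D (h + k) = D h + D k"
    and D_scale: "\<And>c h. h \<in> F \<Longrightarrow> D (c *\<^sub>R h) = c *\<^sub>R D h"
    and K0: "\<And>h. h \<in> F \<Longrightarrow> norm (D h) \<le> K0 * norm h"
    unfolding bounded_linear_on_def by blast
  define K where "K = max K0 1"
  have K: "norm (D h) \<le> K * norm h" if "h \<in> F" for h
    using K0[OF that] mult_right_mono[of K0 K "norm h"] by (simp add: K_def)
  have K_pos: "K > 0" by (simp add: K_def)
  obtain M where M: "\<And>h. norm (p' h) \<le> norm h * M" and M_pos: "M > 0"
    using p'.pos_bounded by blast
  have bl: "bounded_linear (\<lambda>h. D (p' h))"
  proof (rule bounded_linear_intro)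
    show "norm (D (p' h)) \<le> norm h * (M * K)" for h
      using order_trans[OF K[OF p'F[of h]] mult_left_mono[OF M[of h], of K]] K_pos
      by (simp add: mult_ac)
  qed (simp_all add: p'.add p'.scaleR D_add D_scale p'F)
  show ?thesis unfolding has_derivative_at_alt
  proof (intro conjI bl allI impI)
    fix e :: real assume e: "e > 0"
    \<comment> \<open>The remainder of \<open>q\<close> is at most \<open>e1 * norm (p y - p x) \<le> e1 * (M + 1) * norm (y - x)\<close>, and \<open>D\<close> applied
        to the remainder of \<open>p\<close> is at most \<open>K * e2 * norm (y - x)\<close>; each gets half of \<open>e\<close>.\<close>
    define e1 where "e1 = e / (2 * (M + 1))"
    define e2 where "e2 = min 1 (e / (2 * K))"
    have pos: "e1 > 0" "e2 > 0" using e M_pos K_pos by (auto simp: e1_def e2_def)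
    have "\<forall>\<^sub>F w in at (p x) within W. norm ((q w - q (p x) - D (w - p x)) /\<^sub>R norm (w - p x)) < e1"
      using q[THEN tendstoD, OF pos(1)] by simp
    then obtain d1 where d1: "d1 > 0" "\<And>w. \<lbrakk>w \<in> W; w \<noteq> p x; dist w (p x) < d1\<rbrakk> \<Longrightarrow>
        norm ((q w - q (p x) - D (w - p x)) /\<^sub>R norm (w - p x)) < e1"
      unfolding eventually_at by blast
    have rem_q: "norm (q w - q (p x) - D (w - p x)) \<le> e1 * norm (w - p x)"
      if "w \<in> W" "dist w (p x) < d1" for w
    proof (cases "w = p x")
      case True
      have "D 0 = 0" using D_scale[of 0 0] F(1) by (simp add: subspace_0)
      then show ?thesis by (simp add: True)
    next
      case False
      then show ?thesis using d1(2)[OF that(1) False that(2)]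
        by (simp only: norm_scaleR norm_inverse real_norm_def abs_norm_cancel) (simp add: field_simps)
    qed
    have "isCont p x" using p by (rule has_derivative_continuous)
    then have "\<forall>\<^sub>F y in nhds x. dist (p y) (p x) < d1"
      using d1(1) tendstoD continuous_at_imp_continuous_at_within
      by (metis isCont_def tendsto_nhds_iff)
    then have "\<forall>\<^sub>F y in nhds x. p y \<in> W \<and> dist (p y) (p x) < d1"
      using ev by eventually_elim simp
    then obtain d2 where d2: "d2 > 0"
        "\<And>y. dist y x < d2 \<Longrightarrow> p y \<in> W \<and> dist (p y) (p x) < d1"
      unfolding eventually_nhds_metric by blast
    obtain d3 where d3: "d3 > 0"
        "\<And>y. norm (y - x) < d3 \<Longrightarrow> norm (p y - p x - p' (y - x)) \<le> e2 * norm (y - x)"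
      using p pos(2) unfolding has_derivative_at_alt by blast
    have "norm (q (p y) - q (p x) - D (p' (y - x))) \<le> e * norm (y - x)"
      if y: "norm (y - x) < min d2 d3" for y
    proof -
      let ?r = "p y - p x - p' (y - x)"
      have yW: "p y \<in> W" "dist (p y) (p x) < d1" using d2(2)[of y] y by (auto simp: dist_norm)
      have r: "norm ?r \<le> e2 * norm (y - x)" using d3(2) y by simp
      have rF: "?r \<in> F" using yW px F p'F by (auto intro!: subspace_diff)
      have "D (p y - p x) = D (p' (y - x)) + D ?r"
        using D_add[OF p'F[of "y - x"] rF] by simp
      then have eq: "q (p y) - q (p x) - D (p' (y - x)) = (q (p y) - q (p x) - D (p y - p x)) + D ?r"
        by simp
      have "norm (q (p y) - q (p x) - D (p' (y - x))) \<le> e1 * norm (p y - p x) + K * norm ?r"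
        unfolding eq by (rule norm_triangle_le[OF add_mono[OF rem_q[OF yW] K[OF rF]]])
      also have "norm (p y - p x) \<le> norm (p' (y - x)) + norm ?r"
        using norm_triangle_ineq[of "p' (y - x)" ?r] by simp
      also have "\<dots> \<le> (M + 1) * norm (y - x)"
        using M[of "y - x"] r mult_right_mono[of e2 1 "norm (y - x)"]
        by (simp add: e2_def algebra_simps)
      also have "K * norm ?r \<le> K * (e / (2 * K) * norm (y - x))"
      proof (rule mult_left_mono)
        have "e2 * norm (y - x) \<le> e / (2 * K) * norm (y - x)"
          by (rule mult_right_mono) (auto simp: e2_def)
        then show "norm ?r \<le> e / (2 * K) * norm (y - x)" using r by linarith
      qed (use K_pos in simp)
      finally have "norm (q (p y) - q (p x) - D (p' (y - x)))
          \<le> e1 * ((M + 1) * norm (y - x)) + K * (e / (2 * K) * norm (y - x))"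
        using pos by simp
      also have "\<dots> = e * norm (y - x)"
        using M_pos K_pos by (simp add: e1_def field_simps)
      finally show ?thesis .
    qed
    then show "\<exists>d>0. \<forall>y. norm (y - x) < d \<longrightarrow>
        norm (q (p y) - q (p x) - D (p' (y - x))) \<le> e * norm (y - x)"
      using d2(1) d3(1) by (intro exI[of _ "min d2 d3"]) auto
  qed
qed

lemma bounded_linear_on_compose_has_derivative:
  assumes p: "(p has_derivative p') (at x)"
    and F: "subspace F" "closed F" and ev: "\<forall>\<^sub>F y in nhds x. p y \<in> F"
    and D: "bounded_linear_on F D"
  shows "((\<lambda>y. D (p y)) has_derivative (\<lambda>h. D (p' h))) (at x)"
proof (rule has_derivative_compose_subspace[OF p F order_refl ev D])
  have "D w - D (p x) - D (w - p x) = 0" if "w \<in> F" for w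
  proof -
    have "p x \<in> F" using eventually_nhds_x_imp_x[OF ev] .
    then have "D (p x + (w - p x)) = D (p x) + D (w - p x)"
      using D that subspace_diff[OF F(1)] unfolding bounded_linear_on_def by blast
    then show ?thesis by simp
  qed
  then show "((\<lambda>w. (D w - D (p x) - D (w - p x)) /\<^sub>R norm (w - p x)) \<longlongrightarrow> 0) (at (p x) within F)"
    by (intro tendsto_eventually) (auto simp: eventually_at intro!: exI[of _ 1])
qed

text \<open>
  The functional is the coordinate along a vector \<open>b\<close> that spans \<open>F\<close> modulo \<open>E0\<close>. It is bounded
  because \<open>b\<close> has positive distance \<open>d\<close> from the closed subspace \<open>E0\<close>, so that
  \<open>norm (e + t b) \<ge> \<bar>t\<bar> d\<close> for all \<open>e\<close> in \<open>E0\<close>.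
\<close>

lemma codim_one_functional:
  fixes F :: "'g::real_normed_vector set"
  assumes "quotient_dim_eq F E0 1" and E0: "subspace E0" "closed E0"
  obtains l :: "'g \<Rightarrow> real" where "bounded_linear_on F l" "\<And>f. f \<in> F \<Longrightarrow> l f = 0 \<longleftrightarrow> f \<in> E0"
proof -
  obtain b where b: "independent {b}" "span {b} \<inter> E0 = {0}" "span (E0 \<union> {b}) = F"
    using assms(1) unfolding quotient_dim_eq_def by (metis card_1_singletonE)
  have "b \<noteq> 0" using b(1) dependent_zero by blast
  then have bE0: "b \<notin> E0" using b(2) span_base[of b "{b}"] by blast
  have F_iff: "f \<in> F \<longleftrightarrow> (\<exists>t. f - t *\<^sub>R b \<in> E0)" for f
    using b(3) span_breakdown_eq[of f b E0] E0(1) by (simp add: span_eq_iff[THEN iffD2])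
  have uniq: "t = s" if "f - t *\<^sub>R b \<in> E0" "f - s *\<^sub>R b \<in> E0" for f t s
  proof (rule ccontr)
    assume ne: "t \<noteq> s"
    have "(s - t) *\<^sub>R b \<in> E0" using subspace_diff[OF E0(1) that] by (simp add: algebra_simps)
    then have "inverse (s - t) *\<^sub>R ((s - t) *\<^sub>R b) \<in> E0" by (rule subspace_scale[OF E0(1)])
    then show False using ne bE0 by simp
  qed
  define l where "l f = (THE t. f - t *\<^sub>R b \<in> E0)" for f
  have l_eq: "l f = t" if "f - t *\<^sub>R b \<in> E0" for f t
    unfolding l_def using that uniq by blast
  have l: "f - l f *\<^sub>R b \<in> E0" if "f \<in> F" for f
    using that l_eq by (auto simp: F_iff)
  have "open (- E0)" "b \<in> - E0" using E0 bE0 by auto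
  then obtain d where d: "d > 0" "\<And>y. dist y b < d \<Longrightarrow> y \<notin> E0"
    unfolding open_dist by blast
  have bound: "norm (l f) \<le> inverse d * norm f" if f: "f \<in> F" for f
  proof (cases "l f = 0")
    case False
    have "(- inverse (l f)) *\<^sub>R (f - l f *\<^sub>R b) \<in> E0" by (rule subspace_scale[OF E0(1) l[OF f]])
    then have "b - inverse (l f) *\<^sub>R f \<in> E0" using False by (simp add: algebra_simps)
    then have "d \<le> norm (inverse (l f) *\<^sub>R f)" using d(2)[of "b - inverse (l f) *\<^sub>R f"]
      by (simp add: dist_norm) (metis inverse_eq_divide linorder_not_le)
    then show ?thesis using False d(1) by (simp add: field_simps)
  qed (use d in simp)
  have "bounded_linear_on F l"
    unfolding bounded_linear_on_def
  proof (intro conjI ballI allI exI[of _ "inverse d"])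
    show "l (h + k) = l h + l k" if "h \<in> F" "k \<in> F" for h k
      using subspace_add[OF E0(1) l[OF that(1)] l[OF that(2)]]
      by (intro l_eq) (simp add: algebra_simps)
    show "l (c *\<^sub>R h) = c *\<^sub>R l h" if "h \<in> F" for c h
      using subspace_scale[OF E0(1) l[OF that], of c]
      by (intro l_eq) (simp add: algebra_simps)
  qed (rule bound)
  moreover have "l f = 0 \<longleftrightarrow> f \<in> E0" if "f \<in> F" for f
    using l[OF that] l_eq[of f 0] by auto
  ultimately show thesis by (rule that)
qed

section \<open>Differentiability of the norm from charts of the sphere\<close>

lemma norm_normalize_diff_le:
  assumes "norm x = 1" "y \<noteq> 0"
  shows "norm (y /\<^sub>R norm y - x) \<le> 2 * norm (y - x)"
proof -
  have "y /\<^sub>R norm y - y = (1 - norm y) *\<^sub>R (y /\<^sub>R norm y)"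
    using assms(2) by (simp add: algebra_simps)
  then have "norm (y /\<^sub>R norm y - y) = \<bar>1 - norm y\<bar> * norm (y /\<^sub>R norm y)"
    by (simp only: norm_scaleR)
  then have "norm (y /\<^sub>R norm y - y) = \<bar>1 - norm y\<bar>" using assms(2) by simp
  also have "\<dots> \<le> norm (y - x)"
    using assms(1) norm_triangle_ineq3[of y x] by simp
  finally show ?thesis
    using norm_triangle_ineq[of "y /\<^sub>R norm y - y" "y - x"] by simp
qed

text \<open>
  Such a curve satisfies \<open>norm (c s) \<ge> 1 + s - o(s)\<close>, hence it leaves the sphere for small \<open>s > 0\<close>.
\<close>

lemma tangent_to_sphere_not_radial:
  assumes c: "(c has_derivative (\<lambda>s. s *\<^sub>R x)) (at (0::real))" 
    and ev: "\<forall>\<^sub>F s in nhds 0. norm (c s) = 1"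
    and c0: "c 0 = x" and x: "norm x = 1"
  shows False
proof -
  obtain d1 where d1: "d1 > 0" "\<And>s. norm (s - 0) < d1 \<Longrightarrow>
      norm (c s - c 0 - (s - 0) *\<^sub>R x) \<le> 1/2 * norm (s - 0)"
    using c unfolding has_derivative_at_alt by (meson half_gt_zero zero_less_one)
  obtain d2 where d2: "d2 > 0" "\<And>s. dist s 0 < d2 \<Longrightarrow> norm (c s) = 1"
    using ev unfolding eventually_nhds_metric by blast
  define s where "s = min d1 d2 / 2"
  have s: "s > 0" "s < d1" "s < d2" using d1(1) d2(1) by (auto simp: s_def)
  have "norm (c s - (1 + s) *\<^sub>R x) \<le> s / 2"
    using d1(2)[of s] s c0 by (simp add: algebra_simps)
  moreover have "norm ((1 + s) *\<^sub>R x) = 1 + s" using s x by simp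
  moreover have "norm ((1 + s) *\<^sub>R x) - norm (c s) \<le> norm (c s - (1 + s) *\<^sub>R x)"
    by (metis norm_minus_commute norm_triangle_ineq2)
  moreover have "norm (c s) = 1" using d2(2)[of s] s by (simp add: dist_norm)
  ultimately show False using s by linarith
qed

text \<open>
  For \<open>y\<close> near \<open>x\<close> the normalised point \<open>z = y / norm y\<close> lies on the sphere, so \<open>g z = 0 = g x\<close> and
  therefore \<open>g' (z - x) = o(norm (z - x)) = o(norm (y - x))\<close>. Multiplication by \<open>norm y\<close> gives
  \<open>g' y - norm y * g' x = o(norm (y - x))\<close>, which is the claim after division by \<open>g' x\<close>.
\<close>

lemma norm_has_derivative_of_defining_function:
  fixes g :: "'a::real_normed_vector \<Rightarrow> real"
  assumes g: "(g has_derivative g') (at x)" and x: "norm x = 1" and g'x: "g' x \<noteq> 0"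
    and ev: "\<forall>\<^sub>F y in nhds x. norm y = 1 \<longrightarrow> g y = 0"
  shows "(norm has_derivative (\<lambda>h. g' h / g' x)) (at x)"
proof -
  interpret g': bounded_linear g' using g by (rule has_derivative_bounded_linear)
  have gx: "g x = 0" using eventually_nhds_x_imp_x[OF ev] x by simp
  have bl: "bounded_linear (\<lambda>h. g' h / g' x)"
    by (rule bounded_linear_compose[OF bounded_linear_divide g'.bounded_linear_axioms])
  show ?thesis unfolding has_derivative_at_alt
  proof (intro conjI bl allI impI)
    fix e :: real assume e: "e > 0"
    \<comment> \<open>One factor 2 comes from \<open>norm (z - x) \<le> 2 * norm (y - x)\<close>, the other from \<open>norm y \<le> 2\<close>.\<close>
    define e1 where "e1 = e * \<bar>g' x\<bar> / 4"
    have e1: "e1 > 0" using e g'x by (simp add: e1_def)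
    obtain d1 where d1: "d1 > 0"
        "\<And>z. norm (z - x) < d1 \<Longrightarrow> \<bar>g z - g x - g' (z - x)\<bar> \<le> e1 * norm (z - x)"
      using g e1 unfolding has_derivative_at_alt real_norm_def by blast
    obtain d2 where d2: "d2 > 0" "\<And>z. dist z x < d2 \<Longrightarrow> norm z = 1 \<Longrightarrow> g z = 0"
      using ev unfolding eventually_nhds_metric by blast
    define d where "d = min 1 (min d1 d2 / 2)"
    have d: "d > 0" "d \<le> 1" "2 * d \<le> d1" "2 * d \<le> d2" using d1(1) d2(1) by (auto simp: d_def)
    have "norm (norm y - norm x - g' (y - x) / g' x) \<le> e * norm (y - x)"
      if y: "norm (y - x) < d" for y
    proof -
      have y0: "y \<noteq> 0" using y x d by auto
      have ny: "norm y \<le> 2" using norm_triangle_ineq[of "y - x" x] y x d by simp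
      let ?z = "y /\<^sub>R norm y"
      have zx: "norm (?z - x) \<le> 2 * norm (y - x)" using x y0 by (rule norm_normalize_diff_le)
      then have "norm (?z - x) < d1" "norm (?z - x) < d2" using y d by linarith+
      moreover have "norm ?z = 1" using y0 by simp
      ultimately have "\<bar>g' (?z - x)\<bar> \<le> e1 * norm (?z - x)"
        using d1(2)[of ?z] d2(2)[of ?z] gx by (simp add: dist_norm)
      also have "\<dots> \<le> e1 * (2 * norm (y - x))"
        using zx e1 by (intro mult_left_mono) auto
      finally have "norm y * \<bar>g' (?z - x)\<bar> \<le> 2 * (e1 * (2 * norm (y - x)))"
        using ny e1 by (intro mult_mono) auto
      also have "norm y * \<bar>g' (?z - x)\<bar> = \<bar>g' (norm y *\<^sub>R (?z - x))\<bar>"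
        by (simp only: g'.scaleR real_scaleR_def abs_mult abs_norm_cancel)
      also have "norm y *\<^sub>R (?z - x) = y - norm y *\<^sub>R x"
        using y0 by (simp add: scaleR_diff_right)
      also have "\<bar>g' (y - norm y *\<^sub>R x)\<bar> = \<bar>g' x\<bar> * \<bar>norm y - norm x - g' (y - x) / g' x\<bar>"
      proof -
        have "g' (y - norm y *\<^sub>R x) = - g' x * (norm y - norm x - g' (y - x) / g' x)"
          using g'x x by (simp add: g'.diff g'.scaleR field_simps)
        then show ?thesis by (simp add: abs_mult)
      qed
      finally show ?thesis using g'x by (simp add: e1_def field_simps)
    qed
    then show "\<exists>d>0. \<forall>y. norm (y - x) < d \<longrightarrow>
        norm (norm y - norm x - g' (y - x) / g' x) \<le> e * norm (y - x)"
      using d(1) by blast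
  qed
qed

text \<open>
  If \<open>p' x\<close> were in \<open>E0\<close>, the line \<open>\<phi> x + s (p' x)\<close> would lie in \<open>E0\<close>, and for small \<open>s\<close> in the
  image of the sphere, which is open in \<open>E0\<close>. Its preimage would be a curve on the sphere whose
  velocity at \<open>x\<close> is \<open>D (p' x) = x\<close>, where \<open>D\<close> is the derivative of the inverse chart.
\<close>

lemma chart_derivative_transversal:
  fixes \<phi> :: "'a::banach \<Rightarrow> 'g::banach"
  assumes chart: "submanifold_chart {e. norm e = 1} x U \<phi> F E0" and x: "norm x = 1"
    and p': "(\<phi> has_derivative p') (at x)"
  shows "p' x \<notin> E0"
proof
  assume v: "p' x \<in> E0"
  let ?\<psi> = "inv_into U \<phi>" and ?S = "{e :: 'a. norm e = 1}"
  have U: "open U" "x \<in> U" and F: "subspace F" "closed F" and inj: "inj_on \<phi> U"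
    and inv: "C1_on_subspace F (\<phi> ` U) ?\<psi>" and imF: "\<phi> ` U \<subseteq> F"
    and E0: "subspace E0" "E0 \<subseteq> F" and opS: "openin (top_of_set E0) (\<phi> ` (U \<inter> ?S))"
    using chart openin_subset[of "top_of_set F" "\<phi> ` U"]
    unfolding submanifold_chart_def admissible_chart_def C1_diffeo_onto_open_def splits_def by auto
  have \<psi>\<phi>: "?\<psi> (\<phi> y) = y" if "y \<in> U" for y using inj that by (rule inv_into_f_f)
  obtain D where D: "bounded_linear_on F D"
      "((\<lambda>w. (?\<psi> w - ?\<psi> (\<phi> x) - D (w - \<phi> x)) /\<^sub>R norm (w - \<phi> x)) \<longlongrightarrow> 0) (at (\<phi> x) within \<phi> ` U)"
    using inv U(2) unfolding C1_on_subspace_def by blast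
  have evU: "\<forall>\<^sub>F y in nhds x. y \<in> U" using U by (rule eventually_nhds_in_open)
  have "((\<lambda>y. ?\<psi> (\<phi> y)) has_derivative (\<lambda>h. D (p' h))) (at x)"
    by (rule has_derivative_compose_subspace[OF p' F imF _ D]) (use evU in eventually_elim, simp)
  moreover have "((\<lambda>y. ?\<psi> (\<phi> y)) has_derivative (\<lambda>h. h)) (at x)"
    by (rule has_derivative_transform_within_open[OF has_derivative_ident U]) (simp add: \<psi>\<phi>)
  ultimately have Dp': "D (p' h) = h" for h by (metis has_derivative_unique)
  define c where "c s = \<phi> x + s *\<^sub>R p' x" for s :: real
  have c: "(c has_derivative (\<lambda>s. s *\<^sub>R p' x)) (at 0)"
    unfolding c_def by (auto intro!: derivative_eq_intros)
  have c0: "c 0 = \<phi> x" by (simp add: c_def)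
  have xS: "\<phi> x \<in> \<phi> ` (U \<inter> ?S)" using U x by auto
  then have "\<phi> x \<in> E0" using openin_subset[OF opS] by auto
  then have cE0: "c s \<in> E0" for s
    unfolding c_def by (intro subspace_add subspace_scale E0 v)
  obtain T where T: "open T" "\<phi> ` (U \<inter> ?S) = E0 \<inter> T"
    using opS unfolding openin_open by auto
  have "\<phi> x \<in> T" using xS T by auto
  moreover have "isCont c 0" using c by (rule has_derivative_continuous)
  ultimately have "\<forall>\<^sub>F s in nhds 0. c s \<in> T"
    using T(1) c0 by (metis isCont_def tendsto_nhds_iff topological_tendstoD)
  then have evc: "\<forall>\<^sub>F s in nhds 0. c s \<in> \<phi> ` (U \<inter> ?S)"
    by eventually_elim (use cE0 T in auto)
  have "\<forall>\<^sub>F s in nhds 0. c s \<in> \<phi> ` U"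
    using evc by eventually_elim auto
  then have "((\<lambda>s. ?\<psi> (c s)) has_derivative (\<lambda>s. D (s *\<^sub>R p' x))) (at 0)"
    by (intro has_derivative_compose_subspace[OF c F imF]) (use D c0 in auto)
  moreover have "p' x \<in> F" using v E0 by auto
  then have "(\<lambda>s. D (s *\<^sub>R p' x)) = (\<lambda>s. s *\<^sub>R x)"
    using D(1) Dp' unfolding bounded_linear_on_def by auto
  ultimately have "((\<lambda>s. ?\<psi> (c s)) has_derivative (\<lambda>s. s *\<^sub>R x)) (at 0)" by simp
  moreover have "\<forall>\<^sub>F s in nhds 0. norm (?\<psi> (c s)) = 1"
    using evc by eventually_elim (auto simp: \<psi>\<phi>)
  ultimately show False
    by (rule tangent_to_sphere_not_radial) (simp_all add: c0 \<psi>\<phi> U x)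
qed

text \<open>
  The function \<open>l \<circ> \<phi>\<close>, where \<open>l\<close> has kernel \<open>E0\<close>, vanishes on the sphere, and by transversality its
  derivative does not vanish in the radial direction. One chart serves all points of the sphere in
  its domain, which makes the derivative continuous along the sphere.
\<close>

lemma norm_C1_on_sphere_locally:
  fixes x :: "'a::banach" and \<phi> :: "'a \<Rightarrow> 'g::banach"
  assumes chart: "submanifold_chart {e. norm e = 1} x U \<phi> F E0"
    and codim: "quotient_dim_eq F E0 1"
  obtains L :: "'a \<Rightarrow> 'a \<Rightarrow>\<^sub>L real"
  where "continuous_on (U \<inter> {e. norm e = 1}) L"
    "\<And>z. z \<in> U \<Longrightarrow> norm z = 1 \<Longrightarrow> (norm has_derivative L z) (at z)"
proof -
  let ?S = "{e :: 'a. norm e = 1}"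
  have U: "open U" and F: "subspace F" "closed F" and C1: "C1_on U \<phi>" and imF: "\<phi> ` U \<subseteq> F"
    and E0: "subspace E0" "closed E0" "E0 \<subseteq> F" and opS: "openin (top_of_set E0) (\<phi> ` (U \<inter> ?S))"
    using chart openin_subset[of "top_of_set F" "\<phi> ` U"]
    unfolding submanifold_chart_def admissible_chart_def C1_diffeo_onto_open_def splits_def by auto
  obtain f' :: "'a \<Rightarrow> 'a \<Rightarrow>\<^sub>L 'g"
    where f': "\<And>z. z \<in> U \<Longrightarrow> (\<phi> has_derivative f' z) (at z)" "continuous_on U f'"
    using C1_onE[OF C1] by blast
  obtain l :: "'g \<Rightarrow> real"
    where l: "bounded_linear_on F l" "\<And>f. f \<in> F \<Longrightarrow> l f = 0 \<longleftrightarrow> f \<in> E0"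
    using codim_one_functional[OF codim E0(1,2)] by blast
  have evF: "\<forall>\<^sub>F y in nhds z. \<phi> y \<in> F" if "z \<in> U" for z
    using eventually_nhds_in_open[OF U that] by eventually_elim (use imF in auto)
  have f'F: "f' z h \<in> F" if "z \<in> U" for z h
    by (rule derivative_in_closed_subspace[OF f'(1)[OF that] F evF[OF that]])
  have g': "((\<lambda>y. l (\<phi> y)) has_derivative (\<lambda>h. l (f' z h))) (at z)" if "z \<in> U" for z
    by (rule bounded_linear_on_compose_has_derivative[OF f'(1)[OF that] F evF[OF that] l(1)])
  define G where "G z = Blinfun (\<lambda>h. l (f' z h))" for z
  have G: "G z h = l (f' z h)" if "z \<in> U" for z h
    unfolding G_def
    by (subst bounded_linear_Blinfun_apply) (use has_derivative_bounded_linear[OF g'[OF that]] in auto)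
  have G_cont: "continuous_on U G"
  proof -
    obtain K where K: "\<And>h. h \<in> F \<Longrightarrow> norm (l h) \<le> K * norm h"
      using l(1) unfolding bounded_linear_on_def by blast
    have G_diff: "norm (G y - G z) \<le> (\<bar>K\<bar> * norm (f' y - f' z))" if "y \<in> U" "z \<in> U" for y z
    proof (rule norm_blinfun_bound)
      fix h
      have "f' z h + (f' y h - f' z h) = f' y h" by simp
      then have "l (f' y h) = l (f' z h) + l (f' y h - f' z h)"
        using l(1) f'F subspace_diff[OF F(1)] that unfolding bounded_linear_on_def by metis
      then have "norm ((G y - G z) h) = norm (l (f' y h - f' z h))"
        by (simp add: blinfun.diff_left G that)
      also have "\<dots> \<le> K * norm (f' y h - f' z h)"
        by (intro K subspace_diff F f'F that)
      also have "\<dots> \<le> \<bar>K\<bar> * norm ((f' y - f' z) h)"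
        by (intro mult_mono) (auto simp: blinfun.diff_left)
      also have "\<dots> \<le> \<bar>K\<bar> * (norm (f' y - f' z) * norm h)"
        by (intro mult_left_mono norm_blinfun) auto
      finally show "norm ((G y - G z) h) \<le> \<bar>K\<bar> * norm (f' y - f' z) * norm h" by simp
    qed simp
    show ?thesis unfolding continuous_on_def
    proof
      fix z assume z: "z \<in> U"
      have "((\<lambda>y. \<bar>K\<bar> * norm (f' y - f' z)) \<longlongrightarrow> \<bar>K\<bar> * norm (f' z - f' z)) (at z within U)"
        using f'(2) z unfolding continuous_on_def by (intro tendsto_intros) auto
      then have lim: "((\<lambda>y. \<bar>K\<bar> * norm (f' y - f' z)) \<longlongrightarrow> 0) (at z within U)" by simp
      have "\<forall>\<^sub>F y in at z within U. norm (G y - G z) \<le> \<bar>K\<bar> * norm (f' y - f' z)"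
        unfolding eventually_at using G_diff z zero_less_one by blast
      then have "((\<lambda>y. G y - G z) \<longlongrightarrow> 0) (at z within U)"
        using lim by (rule Lim_null_comparison)
      then show "(G \<longlongrightarrow> G z) (at z within U)" by (rule LIM_zero_cancel)
    qed
  qed
  have Gz: "G z z \<noteq> 0" if z: "z \<in> U" "norm z = 1" for z
  proof -
    have "submanifold_chart ?S z U \<phi> F E0"
      using chart z unfolding submanifold_chart_def by blast
    then have "f' z z \<notin> E0"
      using z(2) f'(1)[OF z(1)] by (rule chart_derivative_transversal)
    then show ?thesis using l(2)[OF f'F] z by (simp add: G)
  qed
  show thesis
  proof (rule that[of "\<lambda>z. inverse (G z z) *\<^sub>R G z"])
    show "continuous_on (U \<inter> ?S) (\<lambda>z. inverse (G z z) *\<^sub>R G z)"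
      by (intro continuous_intros continuous_on_subset[OF G_cont]) (use Gz in auto)
    fix z assume z: "z \<in> U" "norm z = 1"
    have "((\<lambda>y. l (\<phi> y)) has_derivative G z) (at z)"
      by (rule has_derivative_eq_rhs[OF g'[OF z(1)]]) (simp add: G z fun_eq_iff)
    moreover have "\<forall>\<^sub>F y in nhds z. norm y = 1 \<longrightarrow> l (\<phi> y) = 0"
      using eventually_nhds_in_open[OF U z(1)]
    proof eventually_elim
      case (elim y)
      have "\<phi> y \<in> E0" if "norm y = 1" using elim that openin_subset[OF opS] by auto
      then show ?case using l(2) E0(3) by auto
    qed
    ultimately have "(norm has_derivative (\<lambda>h. G z h / G z z)) (at z)"
      using z(2) Gz[OF z] by (intro norm_has_derivative_of_defining_function)
    then show "(norm has_derivative (inverse (G z z) *\<^sub>R G z)) (at z)"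
      by (rule has_derivative_eq_rhs) (simp add: blinfun.scaleR_left fun_eq_iff divide_inverse)
  qed
qed

text \<open>
  By uniqueness the local derivatives glue to one function \<open>N\<close> on the sphere. Homogeneity in the
  form \<open>norm u = norm y * norm (u / norm y)\<close> then shows that the derivative at \<open>y\<close> is
  \<open>N (y / norm y)\<close>.
\<close>

lemma norm_C1_of_sphere:
  fixes S :: "'a::banach set"
  assumes S: "S = {e. norm e = 1}"
    and loc: "\<And>x. x \<in> S \<Longrightarrow> \<exists>U L. open U \<and> x \<in> U \<and> continuous_on (U \<inter> S) L \<and>
      (\<forall>z\<in>U \<inter> S. (norm has_derivative blinfun_apply (L z :: 'a \<Rightarrow>\<^sub>L real)) (at z))"
  shows "C1_on (- {0}) (norm :: 'a \<Rightarrow> real)"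
proof -
  define N :: "'a \<Rightarrow> 'a \<Rightarrow>\<^sub>L real" where "N x = (SOME L. (norm has_derivative blinfun_apply L) (at x))" for x
  have N_eq: "N z = L" if "(norm has_derivative blinfun_apply L) (at z)" for z L
  proof -
    have "(norm has_derivative N z) (at z)" unfolding N_def using that by (rule someI)
    then show ?thesis using that has_derivative_unique blinfun_apply_inject by metis
  qed
  have N_cont: "continuous_on S N"
    unfolding continuous_on_def
  proof
    fix x assume x: "x \<in> S"
    then obtain U L where U: "open U" "x \<in> U" and L: "continuous_on (U \<inter> S) L"
        "\<forall>z\<in>U \<inter> S. (norm has_derivative blinfun_apply (L z :: 'a \<Rightarrow>\<^sub>L real)) (at z)"
      using loc[OF x] by (elim exE conjE)
    have "continuous_on (U \<inter> S) N"
      using L(1) by (rule continuous_on_eq) (use L(2) N_eq[symmetric] in auto)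
    then have "(N \<longlongrightarrow> N x) (at x within U \<inter> S)"
      using U x unfolding continuous_on_def by auto
    moreover have "at x within U \<inter> S = at x within S"
      by (rule at_within_nhd[OF U(2,1)]) auto
    ultimately show "(N \<longlongrightarrow> N x) (at x within S)" by simp
  qed
  show ?thesis
  proof (rule C1_onI)
    show "continuous_on (- {0}) (\<lambda>y. N (y /\<^sub>R norm y))"
      by (intro continuous_on_compose2[OF N_cont] continuous_intros) (auto simp: S)
    fix y :: 'a assume "y \<in> - {0}"
    then have y: "norm y > 0" by simp
    define z where "z = y /\<^sub>R norm y"
    have "z \<in> S" using y by (simp add: z_def S)
    then have "(norm has_derivative N z) (at z)"
      using loc N_eq by (metis Int_iff)
    then have outer: "(norm has_derivative N z) (at (y /\<^sub>R norm y))" by (simp add: z_def)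
    have "((\<lambda>u. u /\<^sub>R norm y) has_derivative (\<lambda>h. h /\<^sub>R norm y)) (at y)"
      by (auto intro!: derivative_eq_intros)
    from has_derivative_compose[OF this outer]
    have "((\<lambda>u. norm (u /\<^sub>R norm y)) has_derivative (\<lambda>h. N z (h /\<^sub>R norm y))) (at y)" .
    then have "((\<lambda>u. norm y * norm (u /\<^sub>R norm y)) has_derivative
        (\<lambda>h. norm y * N z (h /\<^sub>R norm y))) (at y)"
      by (rule has_derivative_mult_right)
    moreover have "(\<lambda>u :: 'a. norm y * norm (u /\<^sub>R norm y)) = norm"
      using y by (simp add: fun_eq_iff field_simps)
    moreover have "(\<lambda>h. norm y * N z (h /\<^sub>R norm y)) = N z"
      using y by (simp add: fun_eq_iff blinfun.scaleR_right field_simps)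
    ultimately have "(norm has_derivative N z) (at y)" by (simp only:)
    then show "(norm has_derivative N (y /\<^sub>R norm y)) (at y)" by (simp only: z_def)
  qed
qed

theorem theorem3p2:
  shows "C1_on (- {0}) (norm :: 'a::banach \<Rightarrow> real) \<longleftrightarrow>
    C1_submanifold TYPE('a \<times> 'f::banach) {e :: 'a. norm e = 1} \<and>
    codim_eq TYPE('a \<times> 'f) {e :: 'a. norm e = 1} 1"
proof (intro iffI)
  assume "C1_on (- {0}) (norm :: 'a \<Rightarrow> real)"
  then have "\<exists>U (\<phi> :: 'a \<Rightarrow> 'a \<times> 'f) F E0.
      submanifold_chart {e. norm e = 1} x U \<phi> F E0 \<and> quotient_dim_eq F E0 1" if "norm x = 1" for x :: 'a
    using that by (rule sphere_chart)
  then show "C1_submanifold TYPE('a \<times> 'f) {e :: 'a. norm e = 1} \<and>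
      codim_eq TYPE('a \<times> 'f) {e :: 'a. norm e = 1} 1"
    unfolding C1_submanifold_def codim_eq_def by blast
next
  assume "C1_submanifold TYPE('a \<times> 'f) {e :: 'a. norm e = 1} \<and>
      codim_eq TYPE('a \<times> 'f) {e :: 'a. norm e = 1} 1"
  then have codim: "\<exists>U (\<phi> :: 'a \<Rightarrow> 'a \<times> 'f) F E0.
      submanifold_chart {e. norm e = 1} x U \<phi> F E0 \<and> quotient_dim_eq F E0 1" if "norm x = 1" for x :: 'a
    using that unfolding codim_eq_def by blast
  show "C1_on (- {0}) (norm :: 'a \<Rightarrow> real)"
  proof (rule norm_C1_of_sphere[OF refl])
    fix x :: 'a assume "x \<in> {e. norm e = 1}"
    then obtain U and \<phi> :: "'a \<Rightarrow> 'a \<times> 'f" and F E0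
      where chart: "submanifold_chart {e. norm e = 1} x U \<phi> F E0" "quotient_dim_eq F E0 1"
      using codim by blast
    then obtain L where "continuous_on (U \<inter> {e :: 'a. norm e = 1}) L"
        "\<And>z. z \<in> U \<Longrightarrow> norm z = 1 \<Longrightarrow> (norm has_derivative blinfun_apply (L z)) (at z)"
      using norm_C1_on_sphere_locally[OF chart] by blast
    moreover have "open U" "x \<in> U"
      using chart(1) by (auto simp: submanifold_chart_def admissible_chart_def)
    ultimately show "\<exists>U L. open U \<and> x \<in> U \<and> continuous_on (U \<inter> {e. norm e = 1}) L \<and>
        (\<forall>z\<in>U \<inter> {e. norm e = 1}. (norm has_derivative blinfun_apply (L z)) (at z))"
      by (intro exI[of _ U] exI[of _ L]) auto
  qed
qed

end
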